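(* Let $\Gamma$ be a numerical semigroup with multiplicity $m$, concentration $\mathbf{C}(\Gamma)=k\geq 2$, conductor $c>2m$, and satisfying $e_s\geq 2k$. Then $E(\Gamma)\geq 0$. In particular, any highly dense numerical semigroup $\Gamma$ with $e_s\geq 2k$, where $k=\mathbf{C}(\Gamma)$, has nonnegative Eliahou number $E(\Gamma)\geq 0$.
   Context: $\mathbb{N}$ denotes the set of nonnegative integers. A numerical semigroup $\Gamma$ is an additive submonoid of $(\mathbb{N},+)$ whose elements have greatest common divisor $1$, so that $\mathbb{N}\setminus\Gamma$ is finite; it is assumed that $\Gamma\neq\mathbb{N}$. The multiplicity is $m=m(\Gamma)=\min(\Gamma\setminus\{0\})$, the conductor is $c=c(\Gamma)=\max(\mathbb{N}\setminus\Gamma)+1$, and the delta-invariant $\delta(\Gamma)$ is the number of elements of $\Gamma$ (including $0$) that are smaller than $c$. $G$ denotes the (finite, unique) minimal system of generators of $\Gamma$, and $e(\Gamma)=|G|$ is the embedding dimension. The concentration of $\Gamma$ is $\mathbf{C}(\Gamma)=\max\{\operatorname{next}_\Gamma(s)-s : s\in\Gamma\setminus\{0\}\}$, where $\operatorname{next}_\Gamma(s)=\min\{x\in\Gamma : s<x\}$. $\Gamma$ is called highly dense if one of the following two conditions is satisfied: (1) $\mathbf{C}(\Gamma)\leq 2$; (2) $\mathbf{C}(\Gamma)\leq e(\Gamma)/2$ and $4\leq e(\Gamma)$. Eliahou number: put $q=\lceil c/m\rceil$, $\nu=qm-c$, $J_q=\{c,c+1,\ldots,c+m-1\}$, $p_q=J_q\cap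 G$, $d_q=J_q\setminus p_q$, and $e_s=|\{g\in G : g<c\}|$. Then $E(\Gamma)=e_s\,\delta(\Gamma)-q\,|d_q|+\nu$. *)

theory Defs
  imports Complex_Main "HOL.Hull"
begin

definition add_submonoid :: "nat set \<Rightarrow> bool" where
  "add_submonoid M \<longleftrightarrow> 0 \<in> M \<and> (\<forall>x\<in>M. \<forall>y\<in>M. x + y \<in> M)"

text \<open>The trivial case of all natural numbers is excluded throughout.\<close>

definition numerical_semigroup :: "nat set \<Rightarrow> bool" where
  "numerical_semigroup S \<longleftrightarrow> add_submonoid S \<and> Gcd S = 1 \<and> S \<noteq> UNIV"

definition multiplicity :: "nat set \<Rightarrow> nat" where
  "multiplicity S = (LEAST x. x \<in> S - {0})"

definition conductor :: "nat set \<Rightarrow> nat" where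
  "conductor S = Max (- S) + 1"

definition delta :: "nat set \<Rightarrow> nat" where
  "delta S = card {s \<in> S. s < conductor S}"

definition generates :: "nat set \<Rightarrow> nat set \<Rightarrow> bool" where
  "generates A S \<longleftrightarrow> add_submonoid hull A = S"

definition minimal_generating_set :: "nat set \<Rightarrow> nat set \<Rightarrow> bool" where
  "minimal_generating_set A S \<longleftrightarrow> generates A S \<and> (\<forall>B. B \<subset> A \<longrightarrow> \<not> generates B S)"

definition min_gens :: "nat set \<Rightarrow> nat set" where
  "min_gens S = (THE A. minimal_generating_set A S)"

definition embedding_dim :: "nat set \<Rightarrow> nat" where
  "embedding_dim S = card (min_gens S)"

definition next_elem :: "nat set \<Rightarrow> nat \<Rightarrow> nat" where
  "next_elem S s = (LEAST x. x \<in> S \<and> s < x)"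

definition concentration :: "nat set \<Rightarrow> nat" where
  "concentration S = Max {next_elem S s - s | s. s \<in> S - {0}}"

definition highly_dense :: "nat set \<Rightarrow> bool" where
  "highly_dense S \<longleftrightarrow>
     concentration S \<le> 2 \<or>
     (real (concentration S) \<le> real (embedding_dim S) / 2 \<and> 4 \<le> embedding_dim S)"

definition eliahou_q :: "nat set \<Rightarrow> int" where
  "eliahou_q S = \<lceil>real (conductor S) / real (multiplicity S)\<rceil>"

definition eliahou_nu :: "nat set \<Rightarrow> int" where
  "eliahou_nu S = eliahou_q S * int (multiplicity S) - int (conductor S)"

definition J_q :: "nat set \<Rightarrow> nat set" where
  "J_q S = {conductor S ..< conductor S + multiplicity S}"

definition p_q :: "nat set \<Rightarrow> nat set" where
  "p_q S = J_q S \<inter> min_gens S"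

definition d_q :: "nat set \<Rightarrow> nat set" where
  "d_q S = J_q S - p_q S"

definition e_s :: "nat set \<Rightarrow> nat" where
  "e_s S = card {g \<in> min_gens S. g < conductor S}"

definition eliahou_number :: "nat set \<Rightarrow> int" where
  "eliahou_number S =
     int (e_s S) * int (delta S) - eliahou_q S * int (card (d_q S)) + eliahou_nu S"

text \<open>The definitions above use \<open>THE\<close>, \<open>LEAST\<close> and \<open>Max\<close>; the following facts show that
  these are well defined for every numerical semigroup.\<close>

lemma add_submonoid_hull: "add_submonoid (add_submonoid hull A)"
  by (rule hull_in) (unfold add_submonoid_def, blast)

lemma hull_irreducible:
  assumes "x \<in> add_submonoid hull A" "x \<noteq> 0"
    and irr: "\<And>a b. a \<in> add_submonoid hull A \<Longrightarrow> b \<in> add_submonoid hull A \<Longrightarrow>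
               x = a + b \<Longrightarrow> a = 0 \<or> b = 0"
  shows "x \<in> A"
proof (rule ccontr)
  assume "x \<notin> A"
  define H where "H = add_submonoid hull A"
  have H: "add_submonoid H" unfolding H_def by (rule add_submonoid_hull)
  have "add_submonoid (H - {x})"
    unfolding add_submonoid_def
  proof (intro conjI ballI)
    show "0 \<in> H - {x}" using H assms(2) by (auto simp: add_submonoid_def)
    fix a b assume ab: "a \<in> H - {x}" "b \<in> H - {x}"
    then have "a + b \<in> H" using H by (auto simp: add_submonoid_def)
    moreover have "a + b \<noteq> x" using irr[folded H_def, of a b] ab by auto
    ultimately show "a + b \<in> H - {x}" by auto
  qed
  moreover have "A \<subseteq> H - {x}" using \<open>x \<notin> A\<close> hull_subset[of A add_submonoid] by (auto simp: H_def)
  ultimately have "add_submonoid hull A \<subseteq> H - {x}" by (intro hull_minimal)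
  with assms(1) show False by auto
qed

definition irreducibles :: "nat set \<Rightarrow> nat set" where
  "irreducibles S = {x \<in> S - {0}. \<forall>a\<in>S. \<forall>b\<in>S. x = a + b \<longrightarrow> a = 0 \<or> b = 0}"

lemma irreducibles_generate:
  assumes S: "add_submonoid S"
  shows "generates (irreducibles S) S"
proof -
  let ?H = "add_submonoid hull irreducibles S"
  have H: "add_submonoid ?H" by (rule add_submonoid_hull)
  have "irreducibles S \<subseteq> S" by (auto simp: irreducibles_def)
  then have "?H \<subseteq> S" using S by (rule hull_minimal)
  moreover have "x \<in> S \<longrightarrow> x \<in> ?H" for x
  proof (induction x rule: less_induct)
    case (less x)
    show ?case
    proof
      assume x: "x \<in> S"
      consider "x = 0" | "x \<in> irreducibles S"
        | a b where "a \<in> S" "b \<in> S" "x = a + b" "a \<noteq> 0" "b \<noteq> 0"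
        using x unfolding irreducibles_def by blast
      then show "x \<in> ?H"
      proof cases
        case 1
        then show ?thesis using H by (auto simp: add_submonoid_def)
      next
        case 2
        then show ?thesis by (rule hull_inc)
      next
        case 3
        then have "a \<in> ?H" "b \<in> ?H" using less by auto
        then show ?thesis using H 3 by (auto simp: add_submonoid_def)
      qed
    qed
  qed
  ultimately show ?thesis unfolding generates_def by blast
qed

lemma irreducibles_subset_generating:
  assumes "generates A S"
  shows "irreducibles S \<subseteq> A"
  using hull_irreducible[of _ A] assms unfolding irreducibles_def generates_def by blast

lemma minimal_generating_set_iff:
  assumes "add_submonoid S"
  shows "minimal_generating_set A S \<longleftrightarrow> A = irreducibles S"
  using irreducibles_generate[OF assms] irreducibles_subset_generating[of _ S]
  unfolding minimal_generating_set_def by blast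

lemma min_gens_eq_irreducibles:
  assumes "numerical_semigroup S"
  shows "min_gens S = irreducibles S"
  using assms unfolding min_gens_def numerical_semigroup_def
  by (simp add: minimal_generating_set_iff)

lemma mult_mem:
  assumes "add_submonoid S" "x \<in> S"
  shows "n * x \<in> S"
  using assms by (induction n) (auto simp: add_submonoid_def)

lemma finite_gaps:
  assumes "numerical_semigroup S"
  shows "finite (- S)" "- S \<noteq> {}"
proof -
  have S: "add_submonoid S" and gcd: "Gcd S = 1" and "S \<noteq> UNIV"
    using assms by (auto simp: numerical_semigroup_def)
  have add: "a + b \<in> S" if "a \<in> S" "b \<in> S" for a b
    using S that by (auto simp: add_submonoid_def)
  let ?P = "\<lambda>d. 0 < d \<and> (\<exists>y\<in>S. y + d \<in> S)"
  have "\<exists>s\<in>S. s \<noteq> 0"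
  proof (rule ccontr)
    assume "\<not> (\<exists>s\<in>S. s \<noteq> 0)"
    then have "0 dvd Gcd S" by (intro Gcd_greatest) auto
    then show False using gcd by simp
  qed
  then have ex: "\<exists>d. ?P d" using S by (force simp: add_submonoid_def)
  define d where "d = (LEAST d. ?P d)"
  have "?P d" unfolding d_def using ex by (rule LeastI_ex)
  then obtain y where d: "0 < d" and y: "y \<in> S" "y + d \<in> S" by auto
  have "d dvd s" if s: "s \<in> S" for s
  proof (rule ccontr)
    assume "\<not> d dvd s"
    then have r: "0 < s mod d" by (auto simp: dvd_eq_mod_eq_0)
    have "(s div d) * (y + d) + s mod d = s + (s div d) * y"
      by (simp add: algebra_simps)
    moreover have "s + (s div d) * y \<in> S" "(s div d) * (y + d) \<in> S"
      using add s mult_mem[OF S] y by auto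
    ultimately have "?P (s mod d)" using r by metis
    then have "d \<le> s mod d" unfolding d_def by (rule Least_le)
    then show False using mod_less_divisor[OF d, of s] by linarith
  qed
  then have "d dvd Gcd S" by (rule Gcd_greatest)
  then have y1: "y + 1 \<in> S" using gcd y by simp
  have "n \<in> S" if n: "y * y \<le> n" for n
  proof (cases "y = 0")
    case True
    then show ?thesis using mult_mem[OF S y1, of n] by simp
  next
    case False
    have "n mod y < y" using False by simp
    moreover have "y \<le> n div y" using False n by (simp add: less_eq_div_iff_mult_less_eq)
    ultimately have "n mod y \<le> n div y" by linarith
    then obtain t where t: "n div y = n mod y + t" using le_Suc_ex by blast
    have "n = (n div y) * y + n mod y" by simp
    also have "\<dots> = (n mod y) * (y + 1) + t * y" unfolding t by (simp add: algebra_simps)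
    finally show ?thesis using add mult_mem[OF S] y y1 by metis
  qed
  then have "- S \<subseteq> {..<y * y}" by (metis ComplD lessThan_iff not_le subsetI)
  then show "finite (- S)" by (rule finite_subset) simp
  show "- S \<noteq> {}" using \<open>S \<noteq> UNIV\<close> by auto
qed

lemma conductor_le_mem:
  assumes "numerical_semigroup S" "conductor S \<le> x"
  shows "x \<in> S"
proof (rule ccontr)
  assume "x \<notin> S"
  then have "x \<le> Max (- S)" using finite_gaps[OF assms(1)] by (intro Max_ge) auto
  with assms(2) show False by (simp add: conductor_def)
qed

lemma multiplicity_mem:
  assumes "numerical_semigroup S"
  shows "multiplicity S \<in> S - {0}"
  unfolding multiplicity_def
  by (rule LeastI[of _ "conductor S"])
     (use conductor_le_mem[OF assms order_refl] in \<open>simp add: conductor_def\<close>)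

lemma next_elem_mem:
  assumes "numerical_semigroup S"
  shows "next_elem S s \<in> S \<and> s < next_elem S s"
  unfolding next_elem_def
  by (rule LeastI[of _ "conductor S + s + 1"]) (simp add: conductor_le_mem[OF assms])

lemma finite_min_gens:
  assumes "numerical_semigroup S"
  shows "finite (min_gens S)"
proof -
  let ?m = "multiplicity S" and ?c = "conductor S"
  have m: "?m \<in> S" "?m \<noteq> 0" using multiplicity_mem[OF assms] by auto
  have "x < ?c + ?m + 1" if "x \<in> irreducibles S" for x
  proof (rule ccontr)
    assume "\<not> x < ?c + ?m + 1"
    then have "x = ?m + (x - ?m)" "x - ?m \<noteq> 0" "x - ?m \<in> S"
      using conductor_le_mem[OF assms, of "x - ?m"] by auto
    moreover have "\<And>a b. a \<in> S \<Longrightarrow> b \<in> S \<Longrightarrow> x = a + b \<Longrightarrow> a = 0 \<or> b = 0"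
      using that by (simp add: irreducibles_def)
    ultimately show False using m by metis
  qed
  then have "irreducibles S \<subseteq> {..<?c + ?m + 1}" by blast
  then show ?thesis
    unfolding min_gens_eq_irreducibles[OF assms] by (rule finite_subset) simp
qed

lemma finite_concentration_set:
  assumes "numerical_semigroup S"
  shows "finite {next_elem S s - s | s. s \<in> S - {0}}" "{next_elem S s - s | s. s \<in> S - {0}} \<noteq> {}"
proof -
  have "next_elem S s - s \<le> conductor S + 1" for s
  proof -
    have "next_elem S s \<le> conductor S + s + 1"
      unfolding next_elem_def by (rule Least_le) (simp add: conductor_le_mem[OF assms])
    then show ?thesis by simp
  qed
  then have "{next_elem S s - s | s. s \<in> S - {0}} \<subseteq> {..conductor S + 1}" by auto
  then show "finite {next_elem S s - s | s. s \<in> S - {0}}" by (rule finite_subset) simp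
  show "{next_elem S s - s | s. s \<in> S - {0}} \<noteq> {}" using multiplicity_mem[OF assms] by blast
qed

end

theory Submission
  imports Defs
begin

text \<open>
  Let \<open>m\<close> be the multiplicity, \<open>c\<close> the conductor and \<open>k\<close> the concentration of the semigroup.
  From \<open>m\<close> onwards the semigroup meets every window of \<open>k\<close> consecutive integers, so the
  \<open>c - m\<close> integers of \<open>[m, c)\<close> force at least \<open>(c - m) / k\<close> elements below the conductor besides
  \<open>0\<close> (\<open>concentration_times_delta_ge\<close>). With \<open>e_s \<ge> 2 k\<close> the positive term of the Eliahou
  number is therefore at least \<open>2 k + 2 (c - m)\<close>, and it remains to bound \<open>q |d_q|\<close>.

  If \<open>c \<ge> 2 m\<close>, the bound \<open>|d_q| \<le> m\<close> suffices: since \<open>\<nu> = q m - c\<close>, the multiples of \<open>q m\<close>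
  cancel, which leaves \<open>2 k + c - 2 m \<ge> 0\<close>. If \<open>c < 2 m\<close>, then \<open>q \<le> 2\<close>, and \<open>d_q\<close> is smaller
  than \<open>m\<close>: its elements are decomposable, hence at least \<open>2 m\<close>, so there are at most \<open>c - m\<close> of
  them (\<open>card_d_q_le_conductor\<close>), and what is left is \<open>2 k + \<nu> \<ge> 0\<close>.
\<close>

lemma multiplicity_le:
  assumes "s \<in> S" "s \<noteq> 0"
  shows "multiplicity S \<le> s"
  unfolding multiplicity_def by (rule Least_le) (use assms in simp)

lemma next_elem_le_add_concentration:
  assumes "numerical_semigroup S" "s \<in> S" "s \<noteq> 0"
  shows "next_elem S s \<le> s + concentration S"
proof -
  have "next_elem S s - s \<le> concentration S"
    unfolding concentration_def using assms
    by (intro Max_ge finite_concentration_set) auto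
  then show ?thesis by simp
qed

text \<open>
  The witness is the largest semigroup element \<open>s \<le> x\<close>: its successor lies beyond \<open>x\<close> but is at
  most \<open>s + k\<close>.
\<close>

lemma concentration_window:
  assumes S: "numerical_semigroup S" and x: "multiplicity S \<le> x"
  obtains s where "s \<in> S" "multiplicity S \<le> s" "s \<le> x" "x < s + concentration S"
proof -
  let ?A = "{s \<in> S. s \<le> x}"
  define s where "s = Max ?A"
  have fin: "finite ?A" by simp
  have m: "multiplicity S \<in> ?A" "multiplicity S \<noteq> 0"
    using multiplicity_mem[OF S] x by auto
  have s: "s \<in> ?A" unfolding s_def using fin m(1) by (intro Max_in) auto
  have ms: "multiplicity S \<le> s" unfolding s_def using fin m(1) by (rule Max_ge)
  have "x < next_elem S s"
  proof (rule ccontr)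
    assume "\<not> x < next_elem S s"
    then have "next_elem S s \<in> ?A" using next_elem_mem[OF S, of s] by simp
    then have "next_elem S s \<le> s" unfolding s_def by (intro Max_ge fin)
    then show False using next_elem_mem[OF S, of s] by simp
  qed
  also have "\<dots> \<le> s + concentration S"
    using s ms m(2) by (intro next_elem_le_add_concentration[OF S]) auto
  finally show thesis using s ms by (intro that) auto
qed

text \<open>
  The windows \<open>[s, s + k)\<close> attached to the semigroup elements \<open>s\<close> of \<open>[m, c)\<close> cover that interval.
  The extra summand \<open>k\<close> comes from the element \<open>0\<close>.
\<close>

lemma concentration_times_delta_ge:
  assumes S: "numerical_semigroup S"
  shows "concentration S + (conductor S - multiplicity S) \<le> concentration S * delta S"
proof -
  let ?m = "multiplicity S" and ?c = "conductor S" and ?k = "concentration S"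
  let ?A = "{s \<in> S. ?m \<le> s \<and> s < ?c}"
  have fin: "finite ?A" by simp
  have "{?m..<?c} \<subseteq> (\<Union>s\<in>?A. {s..<s + ?k})"
  proof
    fix x assume x: "x \<in> {?m..<?c}"
    then obtain s where "s \<in> S" "?m \<le> s" "s \<le> x" "x < s + ?k"
      using concentration_window[OF S] by (metis atLeastLessThan_iff)
    then show "x \<in> (\<Union>s\<in>?A. {s..<s + ?k})" using x by force
  qed
  then have "?c - ?m \<le> card (\<Union>s\<in>?A. {s..<s + ?k})"
    using card_mono[of "\<Union>s\<in>?A. {s..<s + ?k}" "{?m..<?c}"] fin by auto
  also have "\<dots> \<le> (\<Sum>s\<in>?A. card {s..<s + ?k})" by (rule card_UN_le[OF fin])
  also have "\<dots> = ?k * card ?A" by simp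
  finally have cover: "?c - ?m \<le> ?k * card ?A" .
  have "0 \<in> S" using S by (simp add: numerical_semigroup_def add_submonoid_def)
  then have "insert 0 ?A \<subseteq> {s \<in> S. s < ?c}" by (auto simp: conductor_def)
  then have "card (insert 0 ?A) \<le> delta S" unfolding delta_def by (intro card_mono) auto
  moreover have "0 \<notin> ?A" using multiplicity_mem[OF S] by simp
  ultimately have "Suc (card ?A) \<le> delta S" using fin by simp
  then have "?k * Suc (card ?A) \<le> ?k * delta S" by (rule mult_le_mono2)
  then show ?thesis using cover by simp
qed

lemma card_d_q_le_multiplicity: "card (d_q S) \<le> multiplicity S"
proof -
  have "card (d_q S) \<le> card (J_q S)" by (rule card_mono) (auto simp: d_q_def J_q_def)
  then show ?thesis by (simp add: J_q_def)
qed

text \<open>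
  A nonzero element that is not a minimal generator is a sum of two nonzero elements, hence at least
  \<open>2 m\<close>; so \<open>d_q\<close> is contained in \<open>[2 m, c + m)\<close>.
\<close>

lemma card_d_q_le_conductor:
  assumes S: "numerical_semigroup S"
  shows "card (d_q S) \<le> conductor S - multiplicity S"
proof -
  let ?m = "multiplicity S" and ?c = "conductor S"
  have "d_q S \<subseteq> {2 * ?m..<?c + ?m}"
  proof
    fix x assume "x \<in> d_q S"
    then have x: "?c \<le> x" "x < ?c + ?m" "x \<notin> irreducibles S"
      by (auto simp: d_q_def p_q_def J_q_def min_gens_eq_irreducibles[OF S])
    have "x \<in> S" "x \<noteq> 0" using conductor_le_mem[OF S x(1)] x(1) by (auto simp: conductor_def)
    then obtain a b where ab: "a \<in> S" "b \<in> S" "x = a + b" "a \<noteq> 0" "b \<noteq> 0"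
      using x(3) unfolding irreducibles_def by blast
    then have "2 * ?m \<le> x"
      using multiplicity_le[of a S] multiplicity_le[of b S] by simp
    then show "x \<in> {2 * ?m..<?c + ?m}" using x by simp
  qed
  then have "card (d_q S) \<le> card {2 * ?m..<?c + ?m}" by (intro card_mono) auto
  then show ?thesis by simp
qed

lemma eliahou_nu_nonneg:
  assumes "numerical_semigroup S"
  shows "0 \<le> eliahou_nu S"
proof -
  have m: "0 < real (multiplicity S)" using multiplicity_mem[OF assms] by simp
  have "real (conductor S) / real (multiplicity S) \<le> of_int (eliahou_q S)"
    unfolding eliahou_q_def by (rule le_of_int_ceiling)
  then have "real_of_int (int (conductor S)) \<le> of_int (eliahou_q S * int (multiplicity S))"
    using m by (simp add: pos_divide_le_eq)
  then show ?thesis unfolding eliahou_nu_def by (simp only: of_int_le_iff)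
qed

lemma eliahou_q_le_2:
  assumes "conductor S \<le> 2 * multiplicity S"
  shows "eliahou_q S \<le> 2"
proof -
  have "real (conductor S) \<le> 2 * real (multiplicity S)" using assms by linarith
  then have "real (conductor S) / real (multiplicity S) \<le> 2"
    by (cases "multiplicity S = 0") (auto simp: divide_le_eq)
  then show ?thesis unfolding eliahou_q_def by (simp add: ceiling_le_iff)
qed

lemma eliahou_q_nonneg: "0 \<le> eliahou_q S"
proof -
  have "0 \<le> real (conductor S) / real (multiplicity S)" by simp
  then show ?thesis unfolding eliahou_q_def by linarith
qed

theorem eliahou_number_nonneg:
  assumes S: "numerical_semigroup S" and e: "2 * concentration S \<le> e_s S"
  shows "0 \<le> eliahou_number S"
proof -
  let ?m = "multiplicity S" and ?c = "conductor S" and ?k = "concentration S"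
  have "2 * (?k + (?c - ?m)) \<le> 2 * ?k * delta S"
    using concentration_times_delta_ge[OF S] by simp
  also have "\<dots> \<le> e_s S * delta S" using e by (rule mult_le_mono1)
  finally have "int (2 * (?k + (?c - ?m))) \<le> int (e_s S * delta S)" by (simp only: of_nat_le_iff)
  then have main: "2 * int (?c - ?m) \<le> int (e_s S) * int (delta S)" by simp
  show ?thesis
  proof (cases "2 * ?m \<le> ?c")
    case True
    have "eliahou_q S * int (card (d_q S)) \<le> eliahou_q S * int ?m"
      using card_d_q_le_multiplicity eliahou_q_nonneg by (intro mult_left_mono) auto
    then show ?thesis using main True unfolding eliahou_number_def eliahou_nu_def by linarith
  next
    case False
    then have "eliahou_q S * int (card (d_q S)) \<le> 2 * int (?c - ?m)"
      using card_d_q_le_conductor[OF S] eliahou_q_le_2[of S] by (intro mult_mono) auto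
    then show ?thesis using main eliahou_nu_nonneg[OF S] unfolding eliahou_number_def by linarith
  qed
qed

theorem corollary5p3:
  fixes \<Gamma> :: "nat set" and k :: nat
  assumes "numerical_semigroup \<Gamma>"
    and "concentration \<Gamma> = k"
    and "e_s \<Gamma> \<ge> 2 * k"
  shows "(k \<ge> 2 \<and> conductor \<Gamma> > 2 * multiplicity \<Gamma> \<longrightarrow> eliahou_number \<Gamma> \<ge> 0) \<and>
         (highly_dense \<Gamma> \<longrightarrow> eliahou_number \<Gamma> \<ge> 0)"
  using eliahou_number_nonneg[of \<Gamma>] assms by simp

end
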